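(* Let $p\ge 1$ be a real number, let $E$ be a Banach space, and let $\omega$ be a control. Let $c_p$ be the constant, depending only on $p$, that appears in the definition of a factorial control for $\omega$ given in the context (namely the constant $c_m$ there for $m=\lfloor p\rfloor+1$). Let $\mathbb{X}:\triangle_2\to T^{(\lfloor p\rfloor)}(E)$ be a $p$-rough path controlled by $\omega$; more precisely, suppose that there exists $$\beta\ \geq\ \lfloor p\rfloor^{1-\frac1p}\,\zeta\Big(\frac{\lfloor p\rfloor+1}{p}\Big)\,2^{\frac{\lfloor p\rfloor+1}{p}}\Big[\exp(\lfloor p\rfloor+1)+\lfloor p\rfloor^{1-\frac1p}c_p\Big]$$ ($\zeta$ being the Riemann zeta function) such that for all $(s,t)\in\triangle_2$ $$\Vert\mathbb{X}^k_{s,t}\Vert\le\frac{\omega(s,t)^{k/p}}{\beta\,(k!)^{1/p}}\qquad\text{for all integers }1\le k\le\lfloor p\rfloor .$$ Then, for the extension of $\mathbb{X}$ to all tensor levels (still denoted $\mathbb{X}$), for all integers $k\ge\lfloor p\rfloor+1$ and all $(s,t)\in\triangle_2$, $$\Vert\mathbb{X}^k_{s,t}\Vert\le\frac{c_p\,\omega(s,t)^{k/p}}{\beta\,(k!)^{1/p}} .$$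
   Context: Notation: $\triangle_n=\{(s_1,\dots,s_n):0\le s_1\le\dots\le s_n\le 1\}$. The tensor powers $E^{\otimes n}$ (with $E^{\otimes 0}=\mathbb{R}$) are equipped with admissible norms $\Vert\cdot\Vert$: permutations of the tensor factors act isometrically and $\Vert a\otimes b\Vert\le\Vert a\Vert\,\Vert b\Vert$ for $a\in E^{\otimes i}$, $b\in E^{\otimes j}$ (e.g. the projective norms). $T^{(n)}(E)=\bigoplus_{i=0}^n E^{\otimes i}$ with the truncated tensor product. $\mathbb{X}^n$ denotes the component of $\mathbb{X}$ in $E^{\otimes n}$. A multiplicative functional is a map $\mathbb{X}$ from $\triangle_2$ to $T^{(n)}(E)$ (or to $\prod_{i\ge0}E^{\otimes i}$) with $\mathbb{X}^0\equiv 1$ and $\mathbb{X}_{s,u}\otimes\mathbb{X}_{u,t}=\mathbb{X}_{s,t}$ for all $s\le u\le t$. A control is a uniformly continuous function $\omega:\triangle_2\to[0,\infty)$ with $\omega(s,u)+\omega(u,t)\le\omega(s,t)$ for all $s\le u\le t$. A $p$-rough path is a multiplicative functional $\mathbb{X}:\triangle_2\to T^{(\lfloor p\rfloor)}(E)$ for which there exist a constant $C$ and a control $\omega$ with $\Vert\mathbb{X}^n_{s,t}\Vert\le C\omega(s,t)^{n/p}$ for all $n\le\lfloor p\rfloor$ and $(s,t)\in\triangle_2$; it is then said to be controlled by $\omega$. Factorial control: given a control $\omega$, a factorial control for $\omega$ is a family of uniformly continuous functions $\triangle_3\to[0,\infty)$, $(u,s,t)\mapsto R_u^{m,n}(s,t)$,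 indexed by integers $1\le m\le n$, together with constants $c_m$ depending only on $m$, such that: (1) for all $u\le v\le s\le t$, $R_u^{m,n}(v,s)^{1/m}+R_u^{m,n}(s,t)^{1/m}\le R_u^{m,n}(v,t)^{1/m}$; (2) for all $0\le k<m$, $\frac{1}{(n-m)!}R_u^{m,n}(s,t)\le\frac{c_m}{(n-m+k)!}R_u^{m-k,n}(s,t)$; (3) $\frac{1}{(n-m)!}R_u^{m,n}(u,t)\le\frac{c_m\,\omega(u,t)^n}{n!}$; (4) $\sum_{i=m}^n\frac{\omega(u,s)^{n-i}\omega(s,t)^i}{(n-i)!\,i!}\le\frac{1}{(n-m)!}R_u^{m,n}(s,t)$; (5) $\sum_{k=1}^{m-1}R_u^{m-k,n-k}(v,s)\frac{\omega(s,t)^k}{k!}\le R_u^{m,n}(v,t)$. A factorial control exists for every control $\omega$, for instance $R_u^{m,n}(s,t)=(\frac mn)^m\frac{1}{m!}\big(\omega(u,t)^{n/m}-\omega(u,s)^{n/m}\big)^m$. Extension: by Lyons' extension theorem, a $p$-rough path controlled by $\omega$ extends uniquely to a multiplicative functional $\mathbb{X}:\triangle_2\to\prod_{i\ge0}E^{\otimes i}$ that is controlled by $\omega$ at all levels, i.e. for every $n$ there is a constant $C_n$ with $\Vert\mathbb{X}^n_{s,t}\Vert\le C_n\omega(s,t)^{n/p}$ for all $(s,t)\in\triangle_2$. *)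

theory Defs
  imports "HOL-Analysis.Analysis"
begin

text \<open>
  All (completed) tensor powers of \<open>E\<close> live in one unital Banach algebra, which receives a linear
  isometry \<open>\<iota>\<close> from \<open>E\<close>; the tensor product is the multiplication of this algebra and
  \<open>e\<^sub>1 \<otimes> \<dots> \<otimes> e\<^sub>n\<close> is \<open>\<iota> e\<^sub>1 * \<dots> * \<iota> e\<^sub>n\<close>. Nothing is lost by this: given arbitrary admissible norms,
  the \<open>\<ell>\<^sup>1\<close>-sum of the completed tensor powers is such an algebra.
\<close>

definition elementary_tensor :: "('e \<Rightarrow> 'a::monoid_mult) \<Rightarrow> 'e list \<Rightarrow> 'a" where
  "elementary_tensor \<iota> es = prod_list (map \<iota> es)"

text \<open>The Banach space completion of the algebraic tensor power, inside the ambient algebra.\<close>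

definition tensor_power :: "('e \<Rightarrow> 'a::real_normed_algebra_1) \<Rightarrow> nat \<Rightarrow> 'a set" where
  "tensor_power \<iota> n = closure (span (elementary_tensor \<iota> ` {es. length es = n}))"

definition multilinear :: "nat \<Rightarrow> ('e::real_vector list \<Rightarrow> 'b::real_vector) \<Rightarrow> bool" where
  "multilinear n f \<longleftrightarrow>
     (\<forall>xs ys. length xs + 1 + length ys = n \<longrightarrow> linear (\<lambda>e. f (xs @ e # ys)))"

text \<open>
  The second conjunct is the universal property of the algebraic tensor power: the span of the
  elementary tensors of length \<open>n\<close> is the algebraic tensor power, and not a proper quotient of it.
  Real-valued multilinear maps suffice; see \<open>tensor_power_universal\<close> below for arbitrary codomains.
  The third conjunct says that permutations of the tensor factors act isometrically. The other
  admissibility condition \<open>\<parallel>a \<otimes> b\<parallel> \<le> \<parallel>a\<parallel> \<parallel>b\<parallel>\<close> is \<open>norm_mult_ineq\<close> of the ambient algebra.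
\<close>

definition admissible_tensor_powers ::
    "('e::banach \<Rightarrow> 'a::{real_normed_algebra_1,banach}) \<Rightarrow> bool" where
  "admissible_tensor_powers \<iota> \<longleftrightarrow>
     (linear \<iota> \<and> (\<forall>e. norm (\<iota> e) = norm e)) \<and>
     (\<forall>n. \<forall>f :: 'e list \<Rightarrow> real. multilinear n f \<longrightarrow>
        (\<exists>g. linear g \<and> (\<forall>es. length es = n \<longrightarrow> g (elementary_tensor \<iota> es) = f es))) \<and>
     (\<forall>n \<pi>. \<pi> permutes {..<n} \<longrightarrow>
        (\<exists>P. linear P \<and>
             (\<forall>es. length es = n \<longrightarrow>
                P (elementary_tensor \<iota> es) = elementary_tensor \<iota> (permute_list \<pi> es)) \<and>
             (\<forall>a \<in> tensor_power \<iota> n. P a \<in> tensor_power \<iota> n \<and> norm (P a) = norm a)))"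

lemma tensor_power_universal:
  fixes f :: "'e::banach list \<Rightarrow> 'b::real_vector"
    and \<iota> :: "'e \<Rightarrow> 'a::{real_normed_algebra_1,banach}"
  assumes adm: "admissible_tensor_powers \<iota>" and f: "multilinear n f"
  shows "\<exists>g. linear g \<and> (\<forall>es. length es = n \<longrightarrow> g (elementary_tensor \<iota> es) = f es)"
proof -
  let ?T = "elementary_tensor \<iota>" and ?W = "{es :: 'e list. length es = n}"
  obtain B where B: "B \<subseteq> ?T ` ?W" "independent B" "?T ` ?W \<subseteq> span B"
    by (rule maximal_independent_subset)
  define w where "w = inv_into ?W ?T"
  have w: "length (w b) = n" "?T (w b) = b" if "b \<in> B" for b
    using inv_into_into[of b ?T ?W] f_inv_into_f[of b ?T ?W] B(1) that by (auto simp: w_def)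
  obtain g where g: "linear g" "\<forall>b\<in>B. g b = f (w b)"
    using linear_independent_extend[OF B(2), of "\<lambda>b. f (w b)"] by auto
  have "g (?T es) = f es" if es: "length es = n" for es
  proof (rule ccontr)
    assume "g (?T es) \<noteq> f es"
    then have "independent {g (?T es) - f es}" by simp
    then obtain \<phi> :: "'b \<Rightarrow> real" where \<phi>: "linear \<phi>" "\<phi> (g (?T es) - f es) = 1"
      using linear_independent_extend[of "{g (?T es) - f es}" "\<lambda>_. 1 :: real"] by auto
    have "multilinear n (\<lambda>es. \<phi> (f es))"
      unfolding multilinear_def
    proof (intro allI impI)
      fix xs ys :: "'e list" assume "length xs + 1 + length ys = n"
      then have "linear (\<lambda>e. f (xs @ e # ys))" using f by (auto simp: multilinear_def)
      from linear_compose[OF this \<phi>(1)] show "linear (\<lambda>e. \<phi> (f (xs @ e # ys)))"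
        by (simp add: o_def)
    qed
    then obtain h where h: "linear h" "\<forall>es. length es = n \<longrightarrow> h (?T es) = \<phi> (f es)"
      using conjunct1[OF conjunct2[OF adm[unfolded admissible_tensor_powers_def]]] by blast
    have lin: "linear (\<lambda>x. \<phi> (g x))"
      using linear_compose[OF g(1) \<phi>(1)] by (simp add: o_def)
    have "h b = \<phi> (g b)" if "b \<in> B" for b
      using h(2)[rule_format, OF w(1)[OF that]] w(2)[OF that] g(2) that by simp
    moreover have "?T es \<in> span B" using B(3) es by blast
    ultimately have "h (?T es) = \<phi> (g (?T es))"
      by (rule linear_eq_on_span[OF h(1) lin])
    moreover have "h (?T es) = \<phi> (f es)" using h(2) es by blast
    ultimately show False using linear_diff[OF \<phi>(1)] \<phi>(2) by simp
  qed
  with g(1) show ?thesis by blast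
qed

definition triangle2 :: "(real \<times> real) set" where
  "triangle2 = {(s, t). 0 \<le> s \<and> s \<le> t \<and> t \<le> 1}"

definition triangle3 :: "(real \<times> real \<times> real) set" where
  "triangle3 = {(u, s, t). 0 \<le> u \<and> u \<le> s \<and> s \<le> t \<and> t \<le> 1}"

definition control :: "(real \<Rightarrow> real \<Rightarrow> real) \<Rightarrow> bool" where
  "control \<omega> \<longleftrightarrow>
     uniformly_continuous_on triangle2 (\<lambda>(s, t). \<omega> s t) \<and>
     (\<forall>(s, t) \<in> triangle2. 0 \<le> \<omega> s t) \<and>
     (\<forall>(s, u, t) \<in> triangle3. \<omega> s u + \<omega> u t \<le> \<omega> s t)"

text \<open>
  \<open>X s t k\<close> is the component of \<open>X\<^sub>s\<^sub>,\<^sub>t\<close> in the \<open>k\<close>-th tensor power. For finite \<open>N\<close> the values are in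
  the truncated tensor algebra and components beyond \<open>N\<close> are irrelevant; \<open>N = \<infinity>\<close> is the case of all
  levels.
\<close>

definition multiplicative_functional ::
    "('e \<Rightarrow> 'a::real_normed_algebra_1) \<Rightarrow> enat \<Rightarrow> (real \<Rightarrow> real \<Rightarrow> nat \<Rightarrow> 'a) \<Rightarrow> bool" where
  "multiplicative_functional \<iota> N X \<longleftrightarrow>
     (\<forall>(s, t) \<in> triangle2. X s t 0 = 1 \<and> (\<forall>k. enat k \<le> N \<longrightarrow> X s t k \<in> tensor_power \<iota> k)) \<and>
     (\<forall>(s, u, t) \<in> triangle3. \<forall>k. enat k \<le> N \<longrightarrow> X s t k = (\<Sum>i\<le>k. X s u i * X u t (k - i)))"

text \<open>
  In the next two definitions level \<open>0\<close>, where the bound reads \<open>1 \<le> C\<close>, is left out, because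
  \<open>0 powr 0 = 0\<close>.
\<close>

definition rough_path_controlled_by ::
    "('e \<Rightarrow> 'a::real_normed_algebra_1) \<Rightarrow> real \<Rightarrow> (real \<Rightarrow> real \<Rightarrow> real) \<Rightarrow>
     (real \<Rightarrow> real \<Rightarrow> nat \<Rightarrow> 'a) \<Rightarrow> bool" where
  "rough_path_controlled_by \<iota> p \<omega> X \<longleftrightarrow>
     control \<omega> \<and>
     multiplicative_functional \<iota> (enat (nat \<lfloor>p\<rfloor>)) X \<and>
     (\<exists>C. \<forall>n. 1 \<le> n \<and> n \<le> nat \<lfloor>p\<rfloor> \<longrightarrow>
        (\<forall>(s, t) \<in> triangle2. norm (X s t n) \<le> C * \<omega> s t powr (real n / p)))"

text \<open>\<open>Y\<close> is the extension of the rough path \<open>X\<close> to all tensor levels.\<close>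

definition lyons_extension ::
    "('e \<Rightarrow> 'a::real_normed_algebra_1) \<Rightarrow> real \<Rightarrow> (real \<Rightarrow> real \<Rightarrow> real) \<Rightarrow>
     (real \<Rightarrow> real \<Rightarrow> nat \<Rightarrow> 'a) \<Rightarrow> (real \<Rightarrow> real \<Rightarrow> nat \<Rightarrow> 'a) \<Rightarrow> bool" where
  "lyons_extension \<iota> p \<omega> X Y \<longleftrightarrow>
     multiplicative_functional \<iota> \<infinity> Y \<and>
     (\<forall>(s, t) \<in> triangle2. \<forall>k \<le> nat \<lfloor>p\<rfloor>. Y s t k = X s t k) \<and>
     (\<forall>n \<ge> 1. \<exists>C. \<forall>(s, t) \<in> triangle2. norm (Y s t n) \<le> C * \<omega> s t powr (real n / p))"

text \<open>\<open>R m n u s t\<close> stands for \<open>R\<^sub>u\<^sup>m\<^sup>,\<^sup>n(s,t)\<close>.\<close>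

definition factorial_control ::
    "(real \<Rightarrow> real \<Rightarrow> real) \<Rightarrow> (nat \<Rightarrow> nat \<Rightarrow> real \<Rightarrow> real \<Rightarrow> real \<Rightarrow> real) \<Rightarrow> (nat \<Rightarrow> real) \<Rightarrow> bool" where
  "factorial_control \<omega> R c \<longleftrightarrow>
     (\<forall>m n. 1 \<le> m \<and> m \<le> n \<longrightarrow>
        uniformly_continuous_on triangle3 (\<lambda>(u, s, t). R m n u s t) \<and>
        (\<forall>(u, s, t) \<in> triangle3. 0 \<le> R m n u s t) \<and>
        (\<forall>u v s t. 0 \<le> u \<and> u \<le> v \<and> v \<le> s \<and> s \<le> t \<and> t \<le> 1 \<longrightarrow>
           R m n u v s powr (1 / real m) + R m n u s t powr (1 / real m)
             \<le> R m n u v t powr (1 / real m)) \<and>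
        (\<forall>k < m. \<forall>(u, s, t) \<in> triangle3.
           R m n u s t / fact (n - m) \<le> c m / fact (n - m + k) * R (m - k) n u s t) \<and>
        (\<forall>(u, t) \<in> triangle2. R m n u u t / fact (n - m) \<le> c m * \<omega> u t ^ n / fact n) \<and>
        (\<forall>(u, s, t) \<in> triangle3.
           (\<Sum>i=m..n. \<omega> u s ^ (n - i) * \<omega> s t ^ i / (fact (n - i) * fact i))
             \<le> R m n u s t / fact (n - m)) \<and>
        (\<forall>u v s t. 0 \<le> u \<and> u \<le> v \<and> v \<le> s \<and> s \<le> t \<and> t \<le> 1 \<longrightarrow>
           (\<Sum>k=1..m-1. R (m - k) (n - k) u v s * \<omega> s t ^ k / fact k) \<le> R m n u v t))"

text \<open>The Riemann zeta function; the series converges for \<open>x > 1\<close> only.\<close>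

definition zeta :: "real \<Rightarrow> real" where
  "zeta x = (\<Sum>n. 1 / real (Suc n) powr x)"

end

theory Submission
  imports Defs
begin

text \<open>
  Put \<open>N = \<lfloor>p\<rfloor>\<close> and \<open>m = N + 1\<close>. A direct induction on the level \<open>n\<close> for \<open>Y\<^sub>s\<^sub>,\<^sub>t\<close> does not close up with
  the factorials: splitting an interval at a point produces the products \<open>Y\<^sub>u\<^sub>,\<^sub>s\<^sup>n\<^sup>-\<^sup>i Y\<^sub>s\<^sub>,\<^sub>t\<^sup>i\<close>, and bounding
  them one at a time and then summing would need a sharp form of the neo-classical inequality. The
  quantity that behaves well is a whole tail of the convolution with a fixed base point \<open>u\<close>,
  \<open>A\<^sup>m\<^sup>,\<^sup>n(s,t) = \<Sum>i=m..n. Y\<^sub>u\<^sub>,\<^sub>s\<^sup>n\<^sup>-\<^sup>i Y\<^sub>s\<^sub>,\<^sub>t\<^sup>i\<close>, and the claim is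
  \<open>\<parallel>A\<^sup>m\<^sup>,\<^sup>n(s,t)\<parallel> \<le> (R\<^sub>u\<^sup>m\<^sup>,\<^sup>n(s,t) / (n-m)!)\<^sup>1\<^sup>/\<^sup>p / \<beta>\<close>, by strong induction on \<open>n\<close> (lemma \<open>tail_bound\<close>). At
  \<open>s = u\<close> the tail is \<open>Y\<^sub>u\<^sub>,\<^sub>t\<^sup>n\<close> itself, and the bound of \<open>R\<^sub>u\<^sup>m\<^sup>,\<^sup>n(u,t)\<close> by \<open>c\<^sub>m \<omega>(u,t)\<^sup>n (n-m)! / n!\<close> gives
  the theorem.

  The tail is almost additive in \<open>(s,t)\<close>: by multiplicativity,
  \<open>A\<^sup>m\<^sup>,\<^sup>n(v,t) - A\<^sup>m\<^sup>,\<^sup>n(v,s) - A\<^sup>m\<^sup>,\<^sup>n(s,t) = \<Sum>j=1..N. A\<^sup>m\<^sup>-\<^sup>j\<^sup>,\<^sup>n\<^sup>-\<^sup>j(v,s) Y\<^sub>s\<^sub>,\<^sub>t\<^sup>j\<close> (lemma \<open>tail_defect\<close>). The right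
  side has only tails of lower degree, and its shape is that of the convolution inequality for
  \<open>R\<close>. A tail \<open>A\<^sup>l\<^sup>,\<^sup>k\<close> with \<open>l \<le> N\<close> is \<open>A\<^sup>m\<^sup>,\<^sup>k\<close>, known by induction, plus at most \<open>N\<close> explicit products,
  which the binomial lower bound for \<open>R\<close> controls (lemma \<open>lower_tail_bound\<close>). So the defect over
  \<open>[v,t]\<close> is at most a constant times \<open>\<beta>\<^sup>-\<^sup>2 R\<^sub>u\<^sup>m\<^sup>,\<^sup>n(v,t)\<^sup>1\<^sup>/\<^sup>p\<close>. Because \<open>R\<^sup>1\<^sup>/\<^sup>m\<close> is superadditive and \<open>m / p > 1\<close>,
  Young's point-removal argument sums these defects at the cost of \<open>2\<^sup>m\<^sup>/\<^sup>p \<zeta>(m/p)\<close>, while the sum of \<open>A\<close>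
  over a fine partition tends to \<open>0\<close> (lemma \<open>sewing_bound\<close>). The lower bound on \<open>\<beta>\<close> says that one
  factor \<open>1 / \<beta>\<close> absorbs all the constants, which closes the induction.

  Moving between sums and \<open>1/p\<close>-th powers needs the power mean inequality, which is responsible for the
  factors \<open>N\<^sup>1\<^sup>-\<^sup>1\<^sup>/\<^sup>p\<close>.
\<close>

section \<open>A power mean inequality\<close>

text \<open>
  Concavity of \<open>x powr q\<close>, in the form of its tangent bound \<open>x powr q \<le> q * x + (1 - q)\<close> at \<open>1\<close>, applied to
  the \<open>a i\<close> divided by \<open>sum a I / N\<close>. Normalising by \<open>N\<close> instead of \<open>card I\<close> gives the same constant for
  all smaller index sets.
\<close>

lemma sum_powr_le_powr_sum:
  fixes a :: "'i \<Rightarrow> real"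
  assumes "finite I" and card: "card I \<le> N" and q: "0 < q" "q \<le> 1" and a: "\<And>i. i \<in> I \<Longrightarrow> 0 \<le> a i"
  shows "(\<Sum>i\<in>I. a i powr q) \<le> real N powr (1 - q) * sum a I powr q"
proof (cases "sum a I = 0")
  case True
  then have "\<And>i. i \<in> I \<Longrightarrow> a i = 0"
    using sum_nonneg_eq_0_iff[OF \<open>finite I\<close>, of a] a by auto
  then show ?thesis by simp
next
  case False
  with a have S: "sum a I > 0" by (simp add: order.strict_iff_order sum_nonneg)
  with card \<open>finite I\<close> have N: "real N > 0" by (cases "N = 0") auto
  define A where "A = sum a I / N"
  have A: "A > 0" using S N by (simp add: A_def)
  have "(\<Sum>i\<in>I. (a i / A) powr q) \<le> (\<Sum>i\<in>I. q * (a i / A) + (1 - q))"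
  proof (rule sum_mono)
    fix i assume "i \<in> I"
    then show "(a i / A) powr q \<le> q * (a i / A) + (1 - q)"
      using Youngs_inequality_0[of q "1 - q" "a i / A" 1] a[of i] A q by (cases "a i = 0") auto
  qed
  also have "\<dots> = q * (sum a I / A) + real (card I) * (1 - q)"
    by (simp add: sum.distrib sum_distrib_left sum_divide_distrib)
  also have "\<dots> \<le> q * real N + real N * (1 - q)"
    using card q S N by (intro add_mono mult_right_mono) (auto simp: A_def)
  finally have "(\<Sum>i\<in>I. (a i / A) powr q) \<le> real N" by (simp add: algebra_simps)
  moreover have "(\<Sum>i\<in>I. (a i / A) powr q) = (\<Sum>i\<in>I. a i powr q) / A powr q"
    unfolding sum_divide_distrib using a A by (intro sum.cong) (auto simp: powr_divide)
  ultimately have "(\<Sum>i\<in>I. a i powr q) \<le> real N * A powr q"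
    using A by (simp add: field_simps)
  also have "\<dots> = real N powr (1 - q) * sum a I powr q"
    using N S by (simp add: A_def powr_divide powr_diff)
  finally show ?thesis .
qed

section \<open>Almost additive functions on intervals\<close>

lemma sum_split_two:
  fixes f :: "nat \<Rightarrow> 'a::comm_monoid_add"
  shows "sum f {..<j + d + 2} = sum f {..<j} + (f j + f (Suc j) + (\<Sum>i<d. f (i + j + 2)))"
  by (induction d) (auto simp: add_ac)

lemma sum_split_one:
  fixes f :: "nat \<Rightarrow> 'a::comm_monoid_add"
  shows "sum f {..<j + d + 1} = sum f {..<j} + (f j + (\<Sum>i<d. f (i + j + 1)))"
  by (induction d) (auto simp: add_ac)

text \<open>
  Both the control itself and the roots of a factorial control with a frozen base point are instances;
  for the latter the interval starts at the base point.
\<close>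

locale superadditive_on =
  fixes a b :: real and \<rho> :: "real \<Rightarrow> real \<Rightarrow> real"
  assumes nonneg: "\<And>s t. a \<le> s \<Longrightarrow> s \<le> t \<Longrightarrow> t \<le> b \<Longrightarrow> 0 \<le> \<rho> s t"
    and superadd: "\<And>s u t. a \<le> s \<Longrightarrow> s \<le> u \<Longrightarrow> u \<le> t \<Longrightarrow> t \<le> b \<Longrightarrow> \<rho> s u + \<rho> u t \<le> \<rho> s t"
begin

lemma mono_right: "a \<le> s \<Longrightarrow> s \<le> u \<Longrightarrow> u \<le> t \<Longrightarrow> t \<le> b \<Longrightarrow> \<rho> s u \<le> \<rho> s t"
  using superadd[of s u t] nonneg[of u t] by auto

lemma diagonal: "a \<le> s \<Longrightarrow> s \<le> b \<Longrightarrow> \<rho> s s = 0"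
  using superadd[of s s s] nonneg[of s s] by auto

lemma sum_le:
  assumes "mono x" "a \<le> x 0" "x r \<le> b"
  shows "(\<Sum>i<r. \<rho> (x i) (x (Suc i))) \<le> \<rho> (x 0) (x r)"
  using assms(3)
proof (induction r)
  case 0
  then show ?case using assms nonneg by simp
next
  case (Suc r)
  have "x 0 \<le> x r" "x r \<le> x (Suc r)" using assms(1) by (auto simp: mono_def)
  with Suc show ?case using superadd[of "x 0" "x r" "x (Suc r)"] assms(2) by force
qed

lemma sum_overlapping_le:
  assumes x: "mono x" "a \<le> x 0" "x (r + 2) \<le> b"
  shows "(\<Sum>i<Suc r. \<rho> (x i) (x (i + 2))) \<le> 2 * \<rho> (x 0) (x (r + 2))"
proof -
  have le: "x i \<le> x j" if "i \<le> j" for i j using x(1) that by (auto simp: mono_def)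
  \<comment> \<open>The intervals of even index are disjoint, and so are those of odd index; the two
    right-hand terms account for one family each, and each induction step feeds one of them.\<close>
  have "(\<Sum>i<Suc k. \<rho> (x i) (x (i + 2))) \<le> \<rho> (x 0) (x (k + 1)) + \<rho> (x 0) (x (k + 2))"
    if "k \<le> r" for k
    using that
  proof (induction k)
    case 0
    have "x 1 \<le> b" using le[of 1 "r + 2"] x(3) by simp
    then show ?case using nonneg[of "x 0" "x 1"] le[of 0 1] x(2) by (simp add: numeral_2_eq_2)
  next
    case (Suc k)
    have "x (k + 3) \<le> b" using le[of "k + 3" "r + 2"] x(3) Suc.prems by simp
    then have "\<rho> (x 0) (x (k + 1)) + \<rho> (x (k + 1)) (x (k + 3)) \<le> \<rho> (x 0) (x (k + 3))"
      using x(2) le[of 0 "k + 1"] le[of "k + 1" "k + 3"] by (intro superadd) auto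
    moreover have "(\<Sum>i<Suc k. \<rho> (x i) (x (i + 2))) \<le> \<rho> (x 0) (x (k + 1)) + \<rho> (x 0) (x (k + 2))"
      using Suc by simp
    moreover have "(\<Sum>i<Suc (Suc k). \<rho> (x i) (x (i + 2)))
        = (\<Sum>i<Suc k. \<rho> (x i) (x (i + 2))) + \<rho> (x (k + 1)) (x (k + 3))"
      by (simp add: numeral_3_eq_3)
    moreover have "Suc k + 1 = k + 2" "Suc k + 2 = k + 3" by simp_all
    ultimately show ?case by (simp add: numeral_3_eq_3)
  qed
  from this[of r] mono_right[of "x 0" "x (r + 1)" "x (r + 2)"] show ?thesis
    using x le[of 0 "r + 1"] le[of "r + 1" "r + 2"] by simp
qed

text \<open>
  Among the \<open>r \<ge> 1\<close> interior points of a partition into \<open>r + 1\<close> intervals there is one whose two neighbours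
  \<open>v\<close>, \<open>t\<close> satisfy \<open>\<rho> v t \<le> 2 / r * \<rho> (x 0) (x (Suc r))\<close>, since the sum over all interior points is at
  most \<open>2 * \<rho> (x 0) (x (Suc r))\<close>. Removing that point changes the sum of \<open>A\<close> by one defect. Repeating
  this until no interior point is left produces the partial sum of the zeta series.
\<close>

lemma point_removal:
  fixes A :: "real \<Rightarrow> real \<Rightarrow> 'v::real_normed_vector"
  assumes \<theta>: "0 \<le> \<theta>" and M: "0 \<le> M"
    and defect: "\<And>v s t. a \<le> v \<Longrightarrow> v \<le> s \<Longrightarrow> s \<le> t \<Longrightarrow> t \<le> b \<Longrightarrow>
      norm (A v t - A v s - A s t) \<le> M * \<rho> v t powr \<theta>"
    and x: "mono x" "a \<le> x 0" "x (Suc r) \<le> b"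
  shows "norm (A (x 0) (x (Suc r)) - (\<Sum>i<Suc r. A (x i) (x (Suc i))))
    \<le> M * (2 powr \<theta> * (\<Sum>k<r. 1 / real (Suc k) powr \<theta>)) * \<rho> (x 0) (x (Suc r)) powr \<theta>"
  using x
proof (induction r arbitrary: x)
  case 0
  then show ?case by simp
next
  case (Suc r)
  note x = Suc.prems
  have le: "x i \<le> x j" if "i \<le> j" for i j using x(1) that by (auto simp: mono_def)
  have le_b: "x i \<le> b" if "i \<le> r + 2" for i using le[OF that] x(3) by simp
  have a_le: "a \<le> x i" for i using le[of 0 i] x(2) by simp
  let ?\<rho> = "\<rho> (x 0) (x (r + 2))"
  have "\<exists>j<Suc r. \<rho> (x j) (x (j + 2)) \<le> 2 / real (Suc r) * ?\<rho>"
  proof (rule ccontr)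
    assume "\<not> ?thesis"
    then have "(\<Sum>j<Suc r. 2 / real (Suc r) * ?\<rho>) < (\<Sum>j<Suc r. \<rho> (x j) (x (j + 2)))"
      by (intro sum_strict_mono) (auto simp: not_le)
    with sum_overlapping_le[of x r] x show False by simp
  qed
  then obtain j where j: "j < Suc r" "\<rho> (x j) (x (j + 2)) \<le> 2 / real (Suc r) * ?\<rho>" by blast
  obtain d where d: "Suc r = j + d + 1" using j(1) less_iff_Suc_add[of j "Suc r"] by auto
  define y where "y i = (if i \<le> j then x i else x (Suc i))" for i
  have y: "mono y" "y 0 = x 0" "y (Suc r) = x (r + 2)"
    using j(1) by (auto simp: y_def mono_def intro!: le)
  let ?Sx = "\<Sum>i<Suc (Suc r). A (x i) (x (Suc i))" and ?Sy = "\<Sum>i<Suc r. A (y i) (y (Suc i))"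
  have "?Sx = (\<Sum>i<j. A (x i) (x (Suc i))) + (A (x j) (x (j + 1)) + A (x (j + 1)) (x (j + 2))
      + (\<Sum>i<d. A (x (i + j + 2)) (x (i + j + 3))))"
    using sum_split_two[of "\<lambda>i. A (x i) (x (Suc i))" j d] d by (simp add: numeral_3_eq_3)
  moreover have "?Sy = (\<Sum>i<j. A (x i) (x (Suc i))) + (A (x j) (x (j + 2))
      + (\<Sum>i<d. A (x (i + j + 2)) (x (i + j + 3))))"
    using sum_split_one[of "\<lambda>i. A (y i) (y (Suc i))" j d] d
    by (simp add: y_def numeral_3_eq_3)
  ultimately have diff: "?Sy - ?Sx = A (x j) (x (j + 2)) - A (x j) (x (j + 1)) - A (x (j + 1)) (x (j + 2))"
    by (simp add: algebra_simps)
  have "norm (?Sy - ?Sx) \<le> M * \<rho> (x j) (x (j + 2)) powr \<theta>"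
    unfolding diff using j(1) by (intro defect a_le le le_b) auto
  also have "\<dots> \<le> M * (2 / real (Suc r) * ?\<rho>) powr \<theta>"
    using j \<theta> M a_le le le_b by (intro mult_left_mono powr_mono2 nonneg) auto
  also have "\<dots> = M * (2 powr \<theta> * (1 / real (Suc r) powr \<theta>)) * ?\<rho> powr \<theta>"
    using nonneg[of "x 0" "x (r + 2)"] le[of 0 "r + 2"] x by (simp add: powr_mult powr_divide)
  finally have step: "norm (?Sy - ?Sx) \<le> M * (2 powr \<theta> * (1 / real (Suc r) powr \<theta>)) * ?\<rho> powr \<theta>" .
  have "norm (A (x 0) (x (r + 2)) - ?Sy)
      \<le> M * (2 powr \<theta> * (\<Sum>k<r. 1 / real (Suc k) powr \<theta>)) * ?\<rho> powr \<theta>"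
    using Suc.IH[of y] y x by simp
  then have "norm (A (x 0) (x (r + 2)) - ?Sx)
      \<le> M * (2 powr \<theta> * (\<Sum>k<r. 1 / real (Suc k) powr \<theta>)) * ?\<rho> powr \<theta>
        + M * (2 powr \<theta> * (1 / real (Suc r) powr \<theta>)) * ?\<rho> powr \<theta>"
    using norm_diff_triangle_le[OF _ step] by blast
  then show ?case by (simp add: algebra_simps)
qed

end

lemma zeta_partial_sum:
  assumes "1 < \<theta>"
  shows "(\<Sum>k<r. 1 / real (Suc k) powr \<theta>) \<le> zeta \<theta>"
proof -
  have "summable (\<lambda>n. real n powr - \<theta>)" using summable_real_powr_iff[of "-\<theta>"] assms by simp
  then have "summable (\<lambda>n. real (Suc n) powr - \<theta>)" by (subst summable_Suc_iff)
  then have "summable (\<lambda>n. 1 / real (Suc n) powr \<theta>)" by (simp add: powr_minus_divide)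
  then show ?thesis unfolding zeta_def by (intro sum_le_suminf) auto
qed

lemma control_superadditive:
  assumes "control \<omega>" shows "superadditive_on 0 1 \<omega>"
  using assms unfolding control_def triangle2_def triangle3_def by unfold_locales auto

text \<open>
  An exponent \<open>\<theta> > 1\<close> leaves a spare factor \<open>\<omega> powr (\<theta> - 1)\<close>. By uniform continuity and since \<open>\<omega>\<close> vanishes
  on the diagonal, this factor is uniformly small on equidistant partitions of small mesh, and what
  remains is summed by superadditivity.
\<close>

lemma sum_powr_control_vanishes:
  assumes ctl: "control \<omega>" and \<theta>: "1 < \<theta>" and st: "0 \<le> s" "s \<le> t" "t \<le> 1" and e: "0 < e"
  obtains x :: "nat \<Rightarrow> real" and r where "mono x" "x 0 = s" "x (Suc r) = t"
    "(\<Sum>i<Suc r. \<omega> (x i) (x (Suc i)) powr \<theta>) \<le> e"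
proof -
  interpret superadditive_on 0 1 \<omega> using ctl by (rule control_superadditive)
  have \<omega>0: "0 \<le> \<omega> s t" using nonneg st by simp
  \<comment> \<open>Chosen so that \<open>\<eta> powr (\<theta> - 1) * \<omega> s t \<le> e\<close>; the summand 1 covers \<open>\<omega> s t = 0\<close>.\<close>
  define \<eta> where "\<eta> = (e / (\<omega> s t + 1)) powr (1 / (\<theta> - 1))"
  have \<eta>: "\<eta> > 0" using e \<omega>0 by (simp add: \<eta>_def)
  have \<eta>': "\<eta> powr (\<theta> - 1) = e / (\<omega> s t + 1)" using e \<omega>0 \<theta> by (simp add: \<eta>_def powr_powr)
  obtain \<delta> where \<delta>: "\<delta> > 0" "\<And>z z'. z \<in> triangle2 \<Longrightarrow> z' \<in> triangle2 \<Longrightarrow> dist z' z < \<delta> \<Longrightarrow>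
      dist (case_prod \<omega> z') (case_prod \<omega> z) < \<eta>"
    using ctl \<eta> unfolding control_def uniformly_continuous_on_def by (metis (no_types, lifting))
  obtain r where r: "inverse (real (Suc r)) < \<delta>" using reals_Archimedean[OF \<delta>(1)] by blast
  define x where "x i = s + real i * ((t - s) / real (Suc r))" for i
  have x: "mono x" "x 0 = s" "x (Suc r) = t"
    using st by (auto simp: x_def mono_def intro!: mult_right_mono divide_right_mono)
  have le: "x i \<le> x j" if "i \<le> j" for i j using x(1) that by (auto simp: mono_def)
  have "\<omega> (x i) (x (Suc i)) powr \<theta> \<le> \<eta> powr (\<theta> - 1) * \<omega> (x i) (x (Suc i))" if i: "i < Suc r" for i
  proof -
    have b: "0 \<le> x i" "x i \<le> x (Suc i)" "x (Suc i) \<le> 1"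
      using le[of 0 i] le[of i "Suc i"] le[of "Suc i" "Suc r"] x i st by auto
    have "x (Suc i) - x i = (t - s) / real (Suc r)" by (simp add: x_def distrib_right add_divide_distrib)
    also have "\<dots> \<le> inverse (real (Suc r))" using st by (simp add: divide_inverse mult_left_le_one_le)
    finally have "dist (x i, x (Suc i)) (x i, x i) < \<delta>" using r b by (simp add: dist_Pair_Pair dist_real_def)
    then have "\<omega> (x i) (x (Suc i)) < \<eta>"
      using \<delta>(2)[of "(x i, x i)" "(x i, x (Suc i))"] b nonneg[of "x i" "x (Suc i)"] diagonal[of "x i"]
      by (simp add: triangle2_def dist_real_def)
    moreover have "\<omega> (x i) (x (Suc i)) \<ge> 0" using nonneg b by simp
    ultimately have "\<omega> (x i) (x (Suc i)) powr (\<theta> - 1) * \<omega> (x i) (x (Suc i)) powr 1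
        \<le> \<eta> powr (\<theta> - 1) * \<omega> (x i) (x (Suc i)) powr 1"
      using \<theta> by (intro mult_right_mono powr_mono2) auto
    then show ?thesis
      using \<open>\<omega> (x i) (x (Suc i)) \<ge> 0\<close> powr_mult_base[of "\<omega> (x i) (x (Suc i))" "\<theta> - 1"]
      by (simp add: mult.commute)
  qed
  then have "(\<Sum>i<Suc r. \<omega> (x i) (x (Suc i)) powr \<theta>)
      \<le> (\<Sum>i<Suc r. \<eta> powr (\<theta> - 1) * \<omega> (x i) (x (Suc i)))"
    by (intro sum_mono) auto
  also have "\<dots> = \<eta> powr (\<theta> - 1) * (\<Sum>i<Suc r. \<omega> (x i) (x (Suc i)))"
    by (rule sum_distrib_left[symmetric])
  also have "\<dots> \<le> \<eta> powr (\<theta> - 1) * \<omega> s t"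
    using sum_le[of x "Suc r"] x st by (intro mult_left_mono) auto
  also have "\<dots> \<le> e" unfolding \<eta>' using e \<omega>0 by (simp add: field_simps)
  finally show thesis using that x by blast
qed

text \<open>
  Point removal compares \<open>A s t\<close> with the sum of \<open>A\<close> over a partition, uniformly in the partition, and
  the hypothesis \<open>small\<close> makes that sum negligible along fine partitions. The functions \<open>\<rho>\<close>, which gives the
  final bound, and \<open>\<omega>\<close>, which is used only to pass to the limit with an arbitrary constant \<open>C\<close>, are
  unrelated.
\<close>

lemma sewing_bound:
  fixes A :: "real \<Rightarrow> real \<Rightarrow> 'v::real_normed_vector"
  assumes ctl: "control \<omega>" and \<theta>: "1 < \<theta>" and M: "0 \<le> M" and C: "0 \<le> C"
    and "superadditive_on u 1 \<rho>" and u: "0 \<le> u"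
    and defect: "\<And>v s t. u \<le> v \<Longrightarrow> v \<le> s \<Longrightarrow> s \<le> t \<Longrightarrow> t \<le> 1 \<Longrightarrow>
      norm (A v t - A v s - A s t) \<le> M * \<rho> v t powr \<theta>"
    and small: "\<And>s t. u \<le> s \<Longrightarrow> s \<le> t \<Longrightarrow> t \<le> 1 \<Longrightarrow> norm (A s t) \<le> C * \<omega> s t powr \<theta>"
    and st: "u \<le> s" "s \<le> t" "t \<le> 1"
  shows "norm (A s t) \<le> M * (2 powr \<theta> * zeta \<theta>) * \<rho> s t powr \<theta>"
proof (rule field_le_epsilon)
  interpret superadditive_on u 1 \<rho> by fact
  fix e :: real assume e: "0 < e"
  from e C have "0 < e / (C + 1)" by simp
  then obtain x :: "nat \<Rightarrow> real" and r where x: "mono x" "x 0 = s" "x (Suc r) = t"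
    "(\<Sum>i<Suc r. \<omega> (x i) (x (Suc i)) powr \<theta>) \<le> e / (C + 1)"
    using sum_powr_control_vanishes[OF ctl \<theta>, of s t "e / (C + 1)"] u st by auto
  have le: "x i \<le> x j" if "i \<le> j" for i j using x(1) that by (auto simp: mono_def)
  let ?S = "\<Sum>i<Suc r. A (x i) (x (Suc i))"
  have "norm ?S \<le> (\<Sum>i<Suc r. norm (A (x i) (x (Suc i))))" by (rule norm_sum)
  also have "\<dots> \<le> (\<Sum>i<Suc r. C * \<omega> (x i) (x (Suc i)) powr \<theta>)"
  proof (rule sum_mono)
    fix i assume "i \<in> {..<Suc r}"
    then show "norm (A (x i) (x (Suc i))) \<le> C * \<omega> (x i) (x (Suc i)) powr \<theta>"
      using le[of 0 i] le[of i "Suc i"] le[of "Suc i" "Suc r"] x st by (intro small) auto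
  qed
  also have "\<dots> = C * (\<Sum>i<Suc r. \<omega> (x i) (x (Suc i)) powr \<theta>)"
    by (rule sum_distrib_left[symmetric])
  also have "\<dots> \<le> C * (e / (C + 1))" using x(4) C by (rule mult_left_mono)
  also have "\<dots> \<le> e" using C e by (simp add: field_simps)
  finally have S: "norm ?S \<le> e" .
  have "norm (A s t - ?S) \<le> M * (2 powr \<theta> * (\<Sum>k<r. 1 / real (Suc k) powr \<theta>)) * \<rho> s t powr \<theta>"
    using point_removal[of \<theta> M A x r] \<theta> M defect x st by simp
  also have "\<dots> \<le> M * (2 powr \<theta> * zeta \<theta>) * \<rho> s t powr \<theta>"
    using M zeta_partial_sum[OF \<theta>] by (intro mult_right_mono mult_left_mono) auto
  finally show "norm (A s t) \<le> M * (2 powr \<theta> * zeta \<theta>) * \<rho> s t powr \<theta> + e"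
    using S norm_triangle_ineq[of "A s t - ?S" ?S] by simp
qed

section \<open>Tails of the convolution\<close>

definition tail :: "(real \<Rightarrow> real \<Rightarrow> nat \<Rightarrow> 'a::ring_1) \<Rightarrow> nat \<Rightarrow> nat \<Rightarrow> real \<Rightarrow> real \<Rightarrow> real \<Rightarrow> 'a" where
  "tail Y m n u s t = (\<Sum>i=m..n. Y u s (n - i) * Y s t i)"

text \<open>
  Expand \<open>Y\<^sub>v\<^sub>,\<^sub>t\<close> in \<open>A\<^sup>m\<^sup>,\<^sup>n(v,t)\<close> at \<open>s\<close> and collect the terms by the degree \<open>j\<close> of their factor \<open>Y\<^sub>s\<^sub>,\<^sub>t\<close>. Degree
  \<open>0\<close> gives \<open>A\<^sup>m\<^sup>,\<^sup>n(v,s)\<close>. For \<open>j \<ge> m\<close> the remaining factor is a complete convolution, hence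
  \<open>Y\<^sub>u\<^sub>,\<^sub>s\<^sup>n\<^sup>-\<^sup>j\<close>, and these degrees give \<open>A\<^sup>m\<^sup>,\<^sup>n(s,t)\<close>. For \<open>0 < j < m\<close> the convolution is cut off and is a
  lower tail.
\<close>

lemma tail_defect:
  fixes Y :: "real \<Rightarrow> real \<Rightarrow> nat \<Rightarrow> 'a::ring_1"
  assumes chen: "\<And>r s t k. u \<le> r \<Longrightarrow> r \<le> s \<Longrightarrow> s \<le> t \<Longrightarrow> t \<le> b \<Longrightarrow> Y r t k = (\<Sum>i\<le>k. Y r s i * Y s t (k - i))"
    and one: "Y s t 0 = 1"
    and ord: "u \<le> v" "v \<le> s" "s \<le> t" "t \<le> b" and mn: "1 \<le> m" "m \<le> n"
  shows "tail Y m n u v t - tail Y m n u v s - tail Y m n u s t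
    = (\<Sum>j=1..m-1. tail Y (m - j) (n - j) u v s * Y s t j)"
proof -
  have rev: "Y r t' k = (\<Sum>i\<le>k. Y r s' (k - i) * Y s' t' i)" if "u \<le> r" "r \<le> s'" "s' \<le> t'" "t' \<le> b" for r s' t' k
    unfolding chen[OF that] by (rule sum.reindex_bij_witness[of _ "\<lambda>i. k - i" "\<lambda>i. k - i"]) auto
  define f where "f i j = Y u v (n - i) * Y v s (i - j) * Y s t j" for i j
  have "tail Y m n u v t = (\<Sum>i=m..n. \<Sum>j\<le>i. f i j)"
    unfolding tail_def f_def using rev[of v s t] ord
    by (auto simp: sum_distrib_left mult.assoc intro!: sum.cong)
  also have "\<dots> = (\<Sum>i=m..n. f i 0 + (\<Sum>j=1..m-1. f i j) + (\<Sum>j=m..i. f i j))"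
  proof (rule sum.cong)
    fix i assume i: "i \<in> {m..n}"
    have "{..i} = insert 0 ({1..m-1} \<union> {m..i})" using i mn by auto
    moreover have "sum (f i) (insert 0 ({1..m-1} \<union> {m..i})) = f i 0 + (sum (f i) {1..m-1} + sum (f i) {m..i})"
      using mn by (subst sum.insert) (auto intro!: sum.union_disjoint)
    ultimately show "sum (f i) {..i} = f i 0 + (\<Sum>j=1..m-1. f i j) + (\<Sum>j=m..i. f i j)"
      by (simp add: add.assoc)
  qed simp
  also have "\<dots> = (\<Sum>i=m..n. f i 0) + (\<Sum>j=1..m-1. \<Sum>i=m..n. f i j) + (\<Sum>i=m..n. \<Sum>j=m..i. f i j)"
    unfolding sum.distrib by (subst sum.swap) (rule refl)
  also have "(\<Sum>i=m..n. f i 0) = tail Y m n u v s"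
    by (simp add: tail_def f_def one)
  also have "(\<Sum>j=1..m-1. \<Sum>i=m..n. f i j) = (\<Sum>j=1..m-1. tail Y (m - j) (n - j) u v s * Y s t j)"
  proof (rule sum.cong)
    fix j assume j: "j \<in> {1..m-1}"
    then have "(\<Sum>i=m..n. f i j) = (\<Sum>l=m-j..n-j. f (l + j) j)"
      using mn by (intro sum.reindex_bij_witness[of _ "\<lambda>l. l + j" "\<lambda>i. i - j"]) auto
    then show "(\<Sum>i=m..n. f i j) = tail Y (m - j) (n - j) u v s * Y s t j"
      by (simp add: tail_def f_def sum_distrib_right add.commute diff_diff_left)
  qed simp
  also have "(\<Sum>i=m..n. \<Sum>j=m..i. f i j) = (\<Sum>j=m..n. \<Sum>i=j..n. f i j)"
  proof -
    have "(\<Sum>i=m..n. \<Sum>j | j \<in> {m..n} \<and> j \<le> i. f i j) = (\<Sum>j=m..n. \<Sum>i | i \<in> {m..n} \<and> j \<le> i. f i j)"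
      by (rule sum.swap_restrict) auto
    moreover have "{j \<in> {m..n}. j \<le> i} = {m..i}" if "i \<in> {m..n}" for i using that by auto
    moreover have "{i \<in> {m..n}. j \<le> i} = {j..n}" if "j \<in> {m..n}" for j using that by auto
    ultimately show ?thesis by simp
  qed
  also have "\<dots> = tail Y m n u s t"
    unfolding tail_def
  proof (rule sum.cong)
    fix j assume j: "j \<in> {m..n}"
    then have "(\<Sum>i=j..n. f i j) = (\<Sum>l\<le>n-j. f (l + j) j)"
      by (intro sum.reindex_bij_witness[of _ "\<lambda>l. l + j" "\<lambda>i. i - j"]) auto
    also have "\<dots> = Y u s (n - j) * Y s t j"
      using rev[of u v s "n - j"] ord
      by (simp add: f_def sum_distrib_right add.commute diff_diff_left)
    finally show "(\<Sum>i=j..n. f i j) = Y u s (n - j) * Y s t j" .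
  qed simp
  finally show ?thesis by simp
qed

section \<open>Factorial controls\<close>

lemma factorial_controlD:
  assumes "factorial_control \<omega> R c" "1 \<le> m" "m \<le> n"
  shows "\<forall>(u, s, t) \<in> triangle3. 0 \<le> R m n u s t"
    and "\<forall>u v s t. 0 \<le> u \<and> u \<le> v \<and> v \<le> s \<and> s \<le> t \<and> t \<le> 1 \<longrightarrow>
      R m n u v s powr (1 / real m) + R m n u s t powr (1 / real m) \<le> R m n u v t powr (1 / real m)"
    and "\<forall>k < m. \<forall>(u, s, t) \<in> triangle3.
      R m n u s t / fact (n - m) \<le> c m / fact (n - m + k) * R (m - k) n u s t"
    and "\<forall>(u, t) \<in> triangle2. R m n u u t / fact (n - m) \<le> c m * \<omega> u t ^ n / fact n"
    and "\<forall>(u, s, t) \<in> triangle3.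
      (\<Sum>i=m..n. \<omega> u s ^ (n - i) * \<omega> s t ^ i / (fact (n - i) * fact i)) \<le> R m n u s t / fact (n - m)"
    and "\<forall>u v s t. 0 \<le> u \<and> u \<le> v \<and> v \<le> s \<and> s \<le> t \<and> t \<le> 1 \<longrightarrow>
      (\<Sum>k=1..m-1. R (m - k) (n - k) u v s * \<omega> s t ^ k / fact k) \<le> R m n u v t"
proof -
  note F = assms(1)[unfolded factorial_control_def, THEN spec, THEN spec, THEN mp, OF conjI[OF assms(2,3)], THEN conjunct2]
  show "\<forall>(u, s, t) \<in> triangle3. 0 \<le> R m n u s t" by (rule F[THEN conjunct1])
  note F = F[THEN conjunct2]
  show "\<forall>u v s t. 0 \<le> u \<and> u \<le> v \<and> v \<le> s \<and> s \<le> t \<and> t \<le> 1 \<longrightarrow>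
      R m n u v s powr (1 / real m) + R m n u s t powr (1 / real m) \<le> R m n u v t powr (1 / real m)"
    by (rule F[THEN conjunct1])
  note F = F[THEN conjunct2]
  show "\<forall>k < m. \<forall>(u, s, t) \<in> triangle3.
      R m n u s t / fact (n - m) \<le> c m / fact (n - m + k) * R (m - k) n u s t"
    by (rule F[THEN conjunct1])
  note F = F[THEN conjunct2]
  show "\<forall>(u, t) \<in> triangle2. R m n u u t / fact (n - m) \<le> c m * \<omega> u t ^ n / fact n"
    by (rule F[THEN conjunct1])
  note F = F[THEN conjunct2]
  show "\<forall>(u, s, t) \<in> triangle3.
      (\<Sum>i=m..n. \<omega> u s ^ (n - i) * \<omega> s t ^ i / (fact (n - i) * fact i)) \<le> R m n u s t / fact (n - m)"
    by (rule F[THEN conjunct1])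
  show "\<forall>u v s t. 0 \<le> u \<and> u \<le> v \<and> v \<le> s \<and> s \<le> t \<and> t \<le> 1 \<longrightarrow>
      (\<Sum>k=1..m-1. R (m - k) (n - k) u v s * \<omega> s t ^ k / fact k) \<le> R m n u v t"
    by (rule F[THEN conjunct2])
qed

text \<open>
  The binomial lower bound and the upper bound on the diagonal enclose \<open>R m m s s t\<close> between
  \<open>\<omega> s t ^ m / fact m\<close> and \<open>c m\<close> times the same number. For the zero control, nothing forces \<open>c m\<close> to be
  positive, and the theorem is then trivial.
\<close>

lemma factorial_control_constant_ge_1:
  assumes fc: "factorial_control \<omega> R c" and m: "1 \<le> m"
    and st: "0 \<le> s" "s \<le> t" "t \<le> 1" and pos: "0 < \<omega> s t"
  shows "1 \<le> c m"
proof -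
  have "\<omega> s t ^ m / fact m \<le> R m m s s t"
    using factorial_controlD(5)[OF fc m order_refl, rule_format, of "(s, s, t)"] st
    by (simp add: triangle3_def)
  moreover have "R m m s s t \<le> c m * (\<omega> s t ^ m / fact m)"
    using factorial_controlD(4)[OF fc m order_refl, rule_format, of "(s, t)"] st
    by (simp add: triangle2_def)
  moreover have "0 < \<omega> s t ^ m / fact m" using pos by simp
  ultimately show ?thesis by (metis mult_1 mult_le_cancel_right_pos order_trans)
qed

section \<open>The induction over the levels\<close>

text \<open>
  The levels are bounded through \<open>\<omega> s t ^ k / fact k\<close> instead of \<open>\<omega> s t powr (k / p)\<close>, because the former is
  \<open>1\<close> at \<open>k = 0\<close> even where \<open>\<omega>\<close> vanishes, so that level \<open>0\<close> needs no separate treatment in the convolutions.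
\<close>

locale small_rough_path =
  fixes p \<beta> :: real and \<omega> :: "real \<Rightarrow> real \<Rightarrow> real"
    and R :: "nat \<Rightarrow> nat \<Rightarrow> real \<Rightarrow> real \<Rightarrow> real \<Rightarrow> real" and c :: "nat \<Rightarrow> real"
    and Y :: "real \<Rightarrow> real \<Rightarrow> nat \<Rightarrow> 'a::real_normed_algebra_1" and N :: nat
  assumes p: "1 \<le> p" and N: "N = nat \<lfloor>p\<rfloor>"
    and ctl: "control \<omega>" and fc: "factorial_control \<omega> R c"
    and c_ge_1: "1 \<le> c (N + 1)"
    and \<beta>: "\<beta> \<ge> real N powr (1 - 1 / p) * zeta (real (N + 1) / p) * 2 powr (real (N + 1) / p) *
             (exp (real (N + 1)) + real N powr (1 - 1 / p) * c (N + 1))"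
    and unit: "\<And>s t. 0 \<le> s \<Longrightarrow> s \<le> t \<Longrightarrow> t \<le> 1 \<Longrightarrow> Y s t 0 = 1"
    and chen: "\<And>s u t k. 0 \<le> s \<Longrightarrow> s \<le> u \<Longrightarrow> u \<le> t \<Longrightarrow> t \<le> 1 \<Longrightarrow>
      Y s t k = (\<Sum>i\<le>k. Y s u i * Y u t (k - i))"
    and low: "\<And>k s t. 1 \<le> k \<Longrightarrow> k \<le> N \<Longrightarrow> 0 \<le> s \<Longrightarrow> s \<le> t \<Longrightarrow> t \<le> 1 \<Longrightarrow>
      norm (Y s t k) \<le> (\<omega> s t ^ k / fact k) powr (1 / p) / \<beta>"
    and regular: "\<And>k. 1 \<le> k \<Longrightarrow> \<exists>C. \<forall>(s, t) \<in> triangle2.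
      norm (Y s t k) \<le> C * \<omega> s t powr (real k / p)"
begin

abbreviation "q \<equiv> 1 / p"
abbreviation "m \<equiv> N + 1"
abbreviation "\<theta> \<equiv> real m / p"

lemma q: "0 < q" "q \<le> 1" using p by auto

lemma N_ge_1: "1 \<le> N" using p N by (simp add: le_nat_floor)

lemma \<theta>_gt_1: "1 < \<theta>"
proof -
  have "p < real m" using N p by linarith
  then show ?thesis using p by simp
qed

sublocale superadditive_on 0 1 \<omega> using ctl by (rule control_superadditive)

lemma factor_ge_1: "1 \<le> real N powr (1 - q)" "1 \<le> zeta \<theta>" "1 \<le> 2 powr \<theta>"
  using N_ge_1 q zeta_partial_sum[OF \<theta>_gt_1, of 1] \<theta>_gt_1 by (auto intro!: ge_one_powr_ge_zero)

text \<open>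
  \<open>K / \<beta>\<close> is the constant in the bound for the tails that start at a level \<open>l \<le> N\<close>: the first summand
  comes from the part above level \<open>N\<close>, the second from the at most \<open>N\<close> products below it.
\<close>

definition K where "K = c m powr q + real N powr (1 - q)"

lemma K_nonneg: "0 \<le> K" by (simp add: K_def)

text \<open>
  The form in which the hypothesis on \<open>\<beta>\<close> closes the induction. The roles of the two summands of the bracket
  are swapped relative to \<open>K\<close>: \<open>c m powr q\<close> is absorbed by the term with \<open>c m\<close>, and \<open>N powr (1 - q) \<le> N\<close>
  by the exponential.
\<close>

lemma K_le: "real N powr (1 - q) * K * (2 powr \<theta> * zeta \<theta>) \<le> \<beta>"
proof -
  have "c m powr q \<le> c m powr 1" using c_ge_1 q by (intro powr_mono) auto
  also have "\<dots> \<le> real N powr (1 - q) * c m"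
    using mult_right_mono[OF factor_ge_1(1), of "c m"] c_ge_1 by simp
  finally have 1: "c m powr q \<le> real N powr (1 - q) * c m" .
  have "real N powr (1 - q) \<le> real N powr 1" using N_ge_1 q by (intro powr_mono) auto
  also have "\<dots> \<le> exp (real m)" using exp_ge_add_one_self[of "real m"] N_ge_1 by simp
  finally have "K \<le> exp (real m) + real N powr (1 - q) * c m"
    using 1 by (simp add: K_def)
  then have "real N powr (1 - q) * zeta \<theta> * 2 powr \<theta> * K
    \<le> real N powr (1 - q) * zeta \<theta> * 2 powr \<theta> * (exp (real m) + real N powr (1 - q) * c m)"
    using factor_ge_1 by (intro mult_left_mono) auto
  with \<beta> show ?thesis by (simp add: mult_ac)
qed

lemma \<beta>_ge: "c m \<le> \<beta>" "1 \<le> \<beta>"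
proof -
  have "1 * c m \<le> real N powr (1 - q) * c m"
    using factor_ge_1(1) c_ge_1 by (intro mult_right_mono) auto
  then have 1: "c m \<le> exp (real m) + real N powr (1 - q) * c m"
    using exp_gt_zero[of "real m"] by linarith
  have "1 * 1 * 1 \<le> real N powr (1 - q) * zeta \<theta> * 2 powr \<theta>"
    using factor_ge_1 by (intro mult_mono) auto
  from mult_mono[OF this 1] c_ge_1 factor_ge_1 \<beta> show "c m \<le> \<beta>" by simp
  with c_ge_1 show "1 \<le> \<beta>" by simp
qed

lemma R_nonneg:
  assumes "1 \<le> l" "l \<le> n" "0 \<le> u" "u \<le> s" "s \<le> t" "t \<le> 1"
  shows "0 \<le> R l n u s t"
  using factorial_controlD(1)[OF fc assms(1,2), rule_format, of "(u, s, t)"] assms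
  by (simp add: triangle3_def)

lemma R_superadditive:
  assumes "1 \<le> l" "l \<le> n" "0 \<le> u"
  shows "superadditive_on u 1 (\<lambda>s t. R l n u s t powr (1 / real l))"
proof
  fix v s t assume "u \<le> v" "v \<le> s" "s \<le> t" "t \<le> 1"
  then show "R l n u v s powr (1 / real l) + R l n u s t powr (1 / real l) \<le> R l n u v t powr (1 / real l)"
    using factorial_controlD(2)[OF fc assms(1,2), rule_format, of u v s t] assms(3) by simp
qed simp

lemma R_lower:
  assumes "1 \<le> l" "l \<le> k" "k \<le> n" "0 \<le> u" "u \<le> s" "s \<le> t" "t \<le> 1"
  shows "R k n u s t / fact (n - k) \<le> c k * (R l n u s t / fact (n - l))"
proof -
  have k: "1 \<le> k" "k - l < k" using assms(1,2) by auto
  have "k - (k - l) = l" "n - k + (k - l) = n - l" using assms by auto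
  with factorial_controlD(3)[OF fc k(1) assms(3), rule_format, OF k(2), of "(u, s, t)"] assms
  show ?thesis by (simp add: triangle3_def)
qed

lemma R_diagonal:
  assumes "1 \<le> l" "l \<le> n" "0 \<le> u" "u \<le> t" "t \<le> 1"
  shows "R l n u u t / fact (n - l) \<le> c l * (\<omega> u t ^ n / fact n)"
  using factorial_controlD(4)[OF fc assms(1,2), rule_format, of "(u, t)"] assms
  by (simp add: triangle2_def)

lemma R_binomial:
  assumes "1 \<le> l" "l \<le> n" "0 \<le> u" "u \<le> s" "s \<le> t" "t \<le> 1"
  shows "(\<Sum>i=l..n. \<omega> u s ^ (n - i) * \<omega> s t ^ i / (fact (n - i) * fact i)) \<le> R l n u s t / fact (n - l)"
  using factorial_controlD(5)[OF fc assms(1,2), rule_format, of "(u, s, t)"] assms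
  by (simp add: triangle3_def)

lemma R_convolution:
  assumes "1 \<le> l" "l \<le> n" "0 \<le> u" "u \<le> v" "v \<le> s" "s \<le> t" "t \<le> 1"
  shows "(\<Sum>k=1..l-1. R (l - k) (n - k) u v s * \<omega> s t ^ k / fact k) \<le> R l n u v t"
  using factorial_controlD(6)[OF fc assms(1,2), rule_format, of u v s t] assms by simp

text \<open>
  The part of the tail above level \<open>N\<close> is the hypothesis \<open>upper\<close>, transferred from \<open>R m n\<close> to \<open>R l n\<close> at the
  price of \<open>c m powr q\<close>. The other products are at most \<open>\<beta>\<^sup>-\<^sup>1\<close> times \<open>q\<close>-th powers of the summands in
  \<open>R_binomial\<close>: the factor \<open>\<beta>\<^sup>-\<^sup>1\<close> comes from \<open>Y s t\<close>, which has level at least \<open>1\<close> and at most \<open>N\<close> there.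
\<close>

lemma lower_tail_bound:
  assumes l: "1 \<le> l" "l \<le> N" "l \<le> n" and ord: "0 \<le> u" "u \<le> s" "s \<le> t" "t \<le> 1"
    and levels: "\<And>k. k < n \<Longrightarrow> norm (Y u s k) \<le> (\<omega> u s ^ k / fact k) powr q"
    and upper: "m \<le> n \<Longrightarrow> norm (tail Y m n u s t) \<le> (R m n u s t / fact (n - m)) powr q / \<beta>"
  shows "norm (tail Y l n u s t) \<le> K / \<beta> * (R l n u s t / fact (n - l)) powr q"
proof -
  let ?R = "R l n u s t / fact (n - l)"
  let ?a = "\<lambda>i. \<omega> u s ^ (n - i) * \<omega> s t ^ i / (fact (n - i) * fact i)"
  let ?I = "{l..min N n}"
  have \<omega>: "0 \<le> \<omega> u s" "0 \<le> \<omega> s t" using nonneg ord by auto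
  have \<beta>0: "0 < \<beta>" using \<beta>_ge by simp
  have R0: "0 \<le> ?R" using R_nonneg[of l n u s t] l ord by simp
  have up: "norm (\<Sum>i=Suc (min N n)..n. Y u s (n - i) * Y s t i) \<le> c m powr q * ?R powr q / \<beta>"
  proof (cases "m \<le> n")
    case True
    then have "norm (\<Sum>i=Suc (min N n)..n. Y u s (n - i) * Y s t i)
      \<le> (R m n u s t / fact (n - m)) powr q / \<beta>"
      using upper by (simp add: tail_def min_def)
    also have "\<dots> \<le> (c m * ?R) powr q / \<beta>"
      using True l ord q \<beta>0 R_nonneg[of m n u s t]
      by (intro divide_right_mono powr_mono2 R_lower) auto
    also have "\<dots> = c m powr q * ?R powr q / \<beta>"
      using c_ge_1 R0 by (subst powr_mult) auto
    finally show ?thesis .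
  next
    case False
    then show ?thesis using \<beta>0 by simp
  qed
  have "norm (\<Sum>i\<in>?I. Y u s (n - i) * Y s t i) \<le> (\<Sum>i\<in>?I. ?a i powr q / \<beta>)"
  proof (rule sum_norm_le)
    fix i assume i: "i \<in> ?I"
    have "norm (Y u s (n - i) * Y s t i) \<le> norm (Y u s (n - i)) * norm (Y s t i)"
      by (rule norm_mult_ineq)
    also have "\<dots> \<le> (\<omega> u s ^ (n - i) / fact (n - i)) powr q * ((\<omega> s t ^ i / fact i) powr q / \<beta>)"
      using i l ord by (intro mult_mono levels low) auto
    also have "\<dots> = ?a i powr q / \<beta>"
      using \<omega> by (simp flip: powr_mult)
    finally show "norm (Y u s (n - i) * Y s t i) \<le> ?a i powr q / \<beta>" .
  qed
  also have "\<dots> = (\<Sum>i\<in>?I. ?a i powr q) / \<beta>" by (rule sum_divide_distrib[symmetric])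
  also have "\<dots> \<le> real N powr (1 - q) * (sum ?a ?I) powr q / \<beta>"
    using q \<omega> \<beta>0 l by (intro divide_right_mono sum_powr_le_powr_sum) auto
  also have "\<dots> \<le> real N powr (1 - q) * ?R powr q / \<beta>"
  proof -
    have "sum ?a ?I \<le> sum ?a {l..n}" using \<omega> by (intro sum_mono2) auto
    also have "\<dots> \<le> ?R" using l ord by (intro R_binomial) auto
    finally show ?thesis
      using q \<omega> \<beta>0 by (intro divide_right_mono mult_left_mono powr_mono2 sum_nonneg) auto
  qed
  finally have "norm (\<Sum>i\<in>?I. Y u s (n - i) * Y s t i) \<le> real N powr (1 - q) * ?R powr q / \<beta>" .
  moreover have "tail Y l n u s t
      = (\<Sum>i\<in>?I. Y u s (n - i) * Y s t i) + (\<Sum>i=Suc (min N n)..n. Y u s (n - i) * Y s t i)"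
  proof -
    have "{l..n} = ?I \<union> {Suc (min N n)..n}" using l by auto
    then show ?thesis unfolding tail_def by (simp only:) (rule sum.union_disjoint; auto)
  qed
  ultimately show ?thesis
    using up norm_triangle_ineq[of "\<Sum>i\<in>?I. Y u s (n - i) * Y s t i"
        "\<Sum>i=Suc (min N n)..n. Y u s (n - i) * Y s t i"]
    by (simp add: K_def distrib_right add_divide_distrib)
qed

lemma level_vanishes_on_diagonal:
  assumes "1 \<le> k" "0 \<le> s" "s \<le> 1" shows "Y s s k = 0"
proof -
  obtain C where "norm (Y s s k) \<le> C * \<omega> s s powr (real k / p)" using regular[OF assms(1)] assms by (auto simp: triangle2_def)
  then show ?thesis using diagonal[of s] assms by simp
qed

lemma tail_at_start:
  assumes "1 \<le> n" "l \<le> n" "0 \<le> u" "u \<le> t" "t \<le> 1"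
  shows "tail Y l n u u t = Y u t n"
proof -
  have "tail Y l n u u t = (\<Sum>i=l..n. if i = n then Y u t n else 0)"
    unfolding tail_def using assms by (intro sum.cong) (auto simp: level_vanishes_on_diagonal unit)
  then show ?thesis using assms by simp
qed

text \<open>
  Every level of \<open>Y s t\<close> from \<open>m\<close> on is of order \<open>\<omega> s t powr \<theta>\<close> or smaller. The constant, which depends on
  \<open>n\<close>, comes from the regularity of the extension alone and only serves to show that sums of tails over fine
  partitions vanish.
\<close>

lemma tail_small:
  assumes "m \<le> n" "0 \<le> u" "u \<le> 1"
  obtains C where "0 \<le> C" "\<And>s t. u \<le> s \<Longrightarrow> s \<le> t \<Longrightarrow> t \<le> 1 \<Longrightarrow> norm (tail Y m n u s t) \<le> C * \<omega> s t powr \<theta>"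
proof -
  let ?W = "\<omega> 0 1"
  have W: "0 \<le> ?W" using nonneg by simp
  have le_W: "\<omega> s t \<le> ?W" if "0 \<le> s" "s \<le> t" "t \<le> 1" for s t
    using superadd[of 0 s t] superadd[of 0 t 1] nonneg[of 0 s] nonneg[of t 1] that by auto
  have "\<forall>k. \<exists>C. 1 \<le> k \<longrightarrow>
      (\<forall>(s, t) \<in> triangle2. norm (Y s t k) \<le> C * \<omega> s t powr (real k / p))"
    using regular by blast
  from choice[OF this] obtain C0 where C0: "\<And>k. 1 \<le> k \<Longrightarrow>
      \<forall>(s, t) \<in> triangle2. norm (Y s t k) \<le> C0 k * \<omega> s t powr (real k / p)"
    by blast
  define C where "C k = \<bar>C0 k\<bar>" for k
  have C: "norm (Y s t k) \<le> C k * \<omega> s t powr (real k / p)" if "1 \<le> k" "0 \<le> s" "s \<le> t" "t \<le> 1" for k s t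
  proof -
    have "norm (Y s t k) \<le> C0 k * \<omega> s t powr (real k / p)"
      using C0[OF that(1)] that(2-) by (auto simp: triangle2_def)
    also have "\<dots> \<le> C k * \<omega> s t powr (real k / p)"
      unfolding C_def by (intro mult_right_mono) auto
    finally show ?thesis .
  qed
  define B where "B k = (if k = 0 then 1 else C k * ?W powr (real k / p))" for k
  have B: "norm (Y s t k) \<le> B k" if "0 \<le> s" "s \<le> t" "t \<le> 1" for k s t
  proof (cases "k = 0")
    case True then show ?thesis using unit that by (simp add: B_def)
  next
    case False
    have "norm (Y s t k) \<le> C k * \<omega> s t powr (real k / p)" using C[of k s t] False that by simp
    also have "\<dots> \<le> C k * ?W powr (real k / p)"
      using le_W[OF that] nonneg that p by (intro mult_left_mono powr_mono2) (auto simp: C_def)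
    finally show ?thesis using False by (simp add: B_def)
  qed
  have B0: "0 \<le> B k" for k by (auto simp: B_def C_def)
  show thesis
  proof
    show "0 \<le> (\<Sum>i=m..n. B (n - i) * (C i * ?W powr (real (i - m) / p)))"
      by (intro sum_nonneg mult_nonneg_nonneg B0) (auto simp: C_def)
    fix s t assume st: "u \<le> s" "s \<le> t" "t \<le> 1"
    have "norm (tail Y m n u s t) \<le> (\<Sum>i=m..n. B (n - i) * (C i * ?W powr (real (i - m) / p)) * \<omega> s t powr \<theta>)"
      unfolding tail_def
    proof (rule sum_norm_le)
      fix i assume i: "i \<in> {m..n}"
      have \<omega>0: "0 \<le> \<omega> s t" using nonneg st assms by simp
      have "norm (Y u s (n - i) * Y s t i) \<le> norm (Y u s (n - i)) * norm (Y s t i)"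
        by (rule norm_mult_ineq)
      also have "\<dots> \<le> B (n - i) * (C i * \<omega> s t powr (real i / p))"
        using i st assms B0 by (intro mult_mono B C) auto
      also have "\<omega> s t powr (real i / p) = \<omega> s t powr (real (i - m) / p) * \<omega> s t powr \<theta>"
        using i by (simp add: of_nat_diff flip: powr_add add_divide_distrib)
      also have "B (n - i) * (C i * (\<omega> s t powr (real (i - m) / p) * \<omega> s t powr \<theta>))
        \<le> B (n - i) * (C i * (?W powr (real (i - m) / p) * \<omega> s t powr \<theta>))"
        using le_W[of s t] \<omega>0 st assms B0 p
        by (intro mult_left_mono mult_right_mono powr_mono2) (auto simp: C_def)
      finally show "norm (Y u s (n - i) * Y s t i)
          \<le> B (n - i) * (C i * ?W powr (real (i - m) / p)) * \<omega> s t powr \<theta>"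
        by (simp add: mult_ac)
    qed
    then show "norm (tail Y m n u s t) \<le> (\<Sum>i=m..n. B (n - i) * (C i * ?W powr (real (i - m) / p))) * \<omega> s t powr \<theta>"
      by (simp only: sum_distrib_right)
  qed
qed

text \<open>
  The defect has total factorial \<open>(n - j) - (m - j) = n - m\<close> in every summand \<open>j\<close>, so that the denominators
  agree and \<open>R_convolution\<close> applies to the sum. The defect carries \<open>\<beta>\<^sup>-\<^sup>2\<close>, one factor from the lower
  tail and one from \<open>Y s t j\<close>; one of them pays for all the constants.
\<close>

lemma tail_bound_step:
  assumes mn: "m \<le> n" and u: "0 \<le> u"
    and levels: "\<And>k s. k < n \<Longrightarrow> u \<le> s \<Longrightarrow> s \<le> 1 \<Longrightarrow> norm (Y u s k) \<le> (\<omega> u s ^ k / fact k) powr q"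
    and IH: "\<And>k s t. m \<le> k \<Longrightarrow> k < n \<Longrightarrow> u \<le> s \<Longrightarrow> s \<le> t \<Longrightarrow> t \<le> 1 \<Longrightarrow>
      norm (tail Y m k u s t) \<le> (R m k u s t / fact (k - m)) powr q / \<beta>"
    and st: "u \<le> s" "s \<le> t" "t \<le> 1"
  shows "norm (tail Y m n u s t) \<le> (R m n u s t / fact (n - m)) powr q / \<beta>"
proof -
  have \<beta>0: "0 < \<beta>" using \<beta>_ge by simp
  define \<rho> where "\<rho> v w = R m n u v w powr (1 / real m)" for v w
  have \<rho>: "\<rho> v w powr \<theta> = R m n u v w powr q" for v w
    by (simp add: \<rho>_def powr_powr)
  define M where "M = K * real N powr (1 - q) / \<beta>\<^sup>2 / fact (n - m) powr q"
  have M0: "0 \<le> M" using K_nonneg by (simp add: M_def)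
  have defect: "norm (tail Y m n u v t - tail Y m n u v s - tail Y m n u s t) \<le> M * \<rho> v t powr \<theta>"
    if ord: "u \<le> v" "v \<le> s" "s \<le> t" "t \<le> 1" for v s t
  proof -
    let ?r = "\<lambda>j. R (m - j) (n - j) u v s"
    let ?b = "\<lambda>j. ?r j * \<omega> s t ^ j / fact j"
    have \<omega>0: "0 \<le> \<omega> s t" using nonneg ord u by simp
    have r0: "0 \<le> ?r j" if "j \<in> {1..N}" for j using R_nonneg[of "m - j" "n - j" u v s] that mn ord u by auto
    have "norm (tail Y m n u v t - tail Y m n u v s - tail Y m n u s t)
      = norm (\<Sum>j=1..N. tail Y (m - j) (n - j) u v s * Y s t j)"
      by (subst tail_defect[where b = 1 and u = u]) (use u ord mn in \<open>auto intro: chen unit\<close>)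
    also have "\<dots> \<le> (\<Sum>j=1..N. K / \<beta>\<^sup>2 / fact (n - m) powr q * ?b j powr q)"
    proof (rule sum_norm_le)
      fix j assume j: "j \<in> {1..N}"
      have sub: "n - j - (m - j) = n - m" using j mn by auto
      have "norm (tail Y (m - j) (n - j) u v s) \<le> K / \<beta> * (?r j / fact (n - j - (m - j))) powr q"
        using j mn u ord by (intro lower_tail_bound levels IH) auto
      note tail = this[unfolded sub]
      have "norm (tail Y (m - j) (n - j) u v s * Y s t j)
        \<le> norm (tail Y (m - j) (n - j) u v s) * norm (Y s t j)" by (rule norm_mult_ineq)
      also have "\<dots> \<le> (K / \<beta> * (?r j / fact (n - m)) powr q) * ((\<omega> s t ^ j / fact j) powr q / \<beta>)"
        using j u ord K_nonneg \<beta>0 by (intro mult_mono tail low) auto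
      also have "\<dots> = K / \<beta>\<^sup>2 / fact (n - m) powr q * ?b j powr q"
        using r0[OF j] \<omega>0 by (simp add: powr_mult powr_divide power2_eq_square mult_ac)
      finally show "norm (tail Y (m - j) (n - j) u v s * Y s t j)
        \<le> K / \<beta>\<^sup>2 / fact (n - m) powr q * ?b j powr q" .
    qed
    also have "\<dots> = K / \<beta>\<^sup>2 / fact (n - m) powr q * (\<Sum>j=1..N. ?b j powr q)"
      by (rule sum_distrib_left[symmetric])
    also have "\<dots> \<le> K / \<beta>\<^sup>2 / fact (n - m) powr q * (real N powr (1 - q) * (\<Sum>j=1..N. ?b j) powr q)"
      using K_nonneg q r0 \<omega>0 by (intro mult_left_mono sum_powr_le_powr_sum) auto
    also have "\<dots> \<le> K / \<beta>\<^sup>2 / fact (n - m) powr q * (real N powr (1 - q) * R m n u v t powr q)"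
      using K_nonneg q r0 \<omega>0 R_convolution[of m n u v s t] mn u ord
      by (intro mult_left_mono powr_mono2 sum_nonneg) auto
    also have "\<dots> = M * \<rho> v t powr \<theta>" unfolding M_def \<rho> by simp
    finally show ?thesis .
  qed
  obtain C where C: "0 \<le> C" "\<And>s t. u \<le> s \<Longrightarrow> s \<le> t \<Longrightarrow> t \<le> 1 \<Longrightarrow> norm (tail Y m n u s t) \<le> C * \<omega> s t powr \<theta>"
    using tail_small[of n u] mn u st by auto
  have "superadditive_on u 1 \<rho>"
    using R_superadditive[of m n u] mn u unfolding \<rho>_def by simp
  then have "norm (tail Y m n u s t) \<le> M * (2 powr \<theta> * zeta \<theta>) * \<rho> s t powr \<theta>"
    using u C st by (intro sewing_bound[OF ctl \<theta>_gt_1 M0 C(1)] defect) auto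
  also have "\<dots> = (real N powr (1 - q) * K * (2 powr \<theta> * zeta \<theta>)) * ((R m n u s t / fact (n - m)) powr q / \<beta>\<^sup>2)"
    unfolding M_def \<rho> using R_nonneg[of m n u s t] mn u st
    by (simp add: powr_divide mult_ac)
  also have "\<dots> \<le> \<beta> * ((R m n u s t / fact (n - m)) powr q / \<beta>\<^sup>2)"
    using K_le by (intro mult_right_mono) auto
  also have "\<dots> = (R m n u s t / fact (n - m)) powr q / \<beta>" by (simp add: power2_eq_square)
  finally show ?thesis .
qed

lemma level_bound_of_tail_bound:
  assumes "m \<le> n" "0 \<le> u" "u \<le> t" "t \<le> 1"
    and tail: "norm (tail Y m n u u t) \<le> (R m n u u t / fact (n - m)) powr q / \<beta>"
  shows "norm (Y u t n) \<le> c m * (\<omega> u t ^ n / fact n) powr q / \<beta>"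
proof -
  have \<beta>0: "0 < \<beta>" using \<beta>_ge by simp
  have \<omega>0: "0 \<le> \<omega> u t" using nonneg assms by simp
  have "norm (Y u t n) \<le> (R m n u u t / fact (n - m)) powr q / \<beta>"
    using tail tail_at_start[of n m u t] assms by simp
  also have "\<dots> \<le> (c m * (\<omega> u t ^ n / fact n)) powr q / \<beta>"
    using \<beta>0 q assms R_diagonal[of m n u t] R_nonneg[of m n u u t]
    by (intro divide_right_mono powr_mono2) auto
  also have "\<dots> = c m powr q * (\<omega> u t ^ n / fact n) powr q / \<beta>"
    using c_ge_1 \<omega>0 by (subst powr_mult) auto
  also have "\<dots> \<le> c m powr 1 * (\<omega> u t ^ n / fact n) powr q / \<beta>"
    using c_ge_1 q \<beta>0 by (intro divide_right_mono mult_right_mono powr_mono) auto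
  finally show ?thesis using c_ge_1 by simp
qed

text \<open>
  To apply the step, the induction hypothesis at level \<open>k < n\<close> is first evaluated at the base point, where it
  bounds \<open>Y u s k\<close> with the constant \<open>c m / \<beta> \<le> 1\<close>.
\<close>

lemma tail_bound:
  assumes "m \<le> n" "0 \<le> u" "u \<le> s" "s \<le> t" "t \<le> 1"
  shows "norm (tail Y m n u s t) \<le> (R m n u s t / fact (n - m)) powr q / \<beta>"
  using assms
proof (induction n arbitrary: s t rule: less_induct)
  case (less n)
  have levels: "norm (Y u s k) \<le> (\<omega> u s ^ k / fact k) powr q" if k: "k < n" and s: "u \<le> s" "s \<le> 1" for k s
  proof -
    consider "k = 0" | "1 \<le> k" "k \<le> N" | "m \<le> k" by linarith
    then show ?thesis
    proof cases
      case 1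
      then show ?thesis using unit[of u s] less.prems s by simp
    next
      case 2
      have "norm (Y u s k) \<le> (\<omega> u s ^ k / fact k) powr q / \<beta>" using low 2 less.prems s by simp
      also have "\<dots> \<le> (\<omega> u s ^ k / fact k) powr q"
        using \<beta>_ge by (intro divide_left_mono[of 1 \<beta>, simplified]) auto
      finally show ?thesis .
    next
      case 3
      have "norm (Y u s k) \<le> c m * (\<omega> u s ^ k / fact k) powr q / \<beta>"
        using 3 k s less by (intro level_bound_of_tail_bound) auto
      also have "\<dots> = c m / \<beta> * (\<omega> u s ^ k / fact k) powr q" by simp
      also have "\<dots> \<le> 1 * (\<omega> u s ^ k / fact k) powr q"
        using \<beta>_ge by (intro mult_right_mono) (auto simp: divide_le_eq)
      finally show ?thesis by simp
    qed
  qed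
  show ?case
    by (rule tail_bound_step[OF _ _ levels less.IH]) (use less.prems in auto)
qed

lemma level_bound:
  assumes "m \<le> n" "0 \<le> s" "s \<le> t" "t \<le> 1"
  shows "norm (Y s t n) \<le> c m * (\<omega> s t ^ n / fact n) powr q / \<beta>"
  using assms by (intro level_bound_of_tail_bound tail_bound) auto

end

lemma powr_ratio_eq:
  assumes "0 \<le> x" "1 \<le> k" "0 < p"
  shows "(x ^ k / fact k) powr (1 / p) = x powr (real k / p) / fact k powr (1 / p)"
  using assms by (cases "x = 0") (auto simp: powr_divide powr_powr simp flip: powr_realpow)

theorem proposition9:
  fixes p \<beta> :: real
    and \<iota> :: "'e::banach \<Rightarrow> 'a::{real_normed_algebra_1,banach}"
    and \<omega> :: "real \<Rightarrow> real \<Rightarrow> real"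
    and R :: "nat \<Rightarrow> nat \<Rightarrow> real \<Rightarrow> real \<Rightarrow> real \<Rightarrow> real"
    and c :: "nat \<Rightarrow> real"
    and X Y :: "real \<Rightarrow> real \<Rightarrow> nat \<Rightarrow> 'a"
    and N :: nat
  assumes "1 \<le> p"
    and "N = nat \<lfloor>p\<rfloor>"
    and "admissible_tensor_powers \<iota>"
    and "control \<omega>"
    and "factorial_control \<omega> R c"
    and "rough_path_controlled_by \<iota> p \<omega> X"
    and "\<beta> \<ge> real N powr (1 - 1 / p) * zeta (real (N + 1) / p) * 2 powr (real (N + 1) / p) *
             (exp (real (N + 1)) + real N powr (1 - 1 / p) * c (N + 1))"
    and "\<And>k s t. 1 \<le> k \<Longrightarrow> k \<le> N \<Longrightarrow> (s, t) \<in> triangle2 \<Longrightarrow>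
           norm (X s t k) \<le> \<omega> s t powr (real k / p) / (\<beta> * fact k powr (1 / p))"
    and "lyons_extension \<iota> p \<omega> X Y"
  shows "\<forall>k \<ge> N + 1. \<forall>(s, t) \<in> triangle2.
           norm (Y s t k) \<le> c (N + 1) * \<omega> s t powr (real k / p) / (\<beta> * fact k powr (1 / p))"
proof (intro allI impI ballI, clarify)
  fix k s t assume k: "N + 1 \<le> k" and in_triangle: "(s, t) \<in> triangle2"
  then have st: "0 \<le> s" "s \<le> t" "t \<le> 1" by (auto simp: triangle2_def)
  interpret superadditive_on 0 1 \<omega> using assms(4) by (rule control_superadditive)
  have mult: "multiplicative_functional \<iota> \<infinity> Y"
    and ext: "\<And>s t k. 0 \<le> s \<Longrightarrow> s \<le> t \<Longrightarrow> t \<le> 1 \<Longrightarrow> k \<le> N \<Longrightarrow> Y s t k = X s t k"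
    and reg: "\<And>n. 1 \<le> n \<Longrightarrow> \<exists>C. \<forall>(s, t) \<in> triangle2. norm (Y s t n) \<le> C * \<omega> s t powr (real n / p)"
    using assms(9) unfolding lyons_extension_def assms(2) by (auto simp: triangle2_def)
  show "norm (Y s t k) \<le> c (N + 1) * \<omega> s t powr (real k / p) / (\<beta> * fact k powr (1 / p))"
  proof (cases "\<omega> s t = 0")
    case True
    \<comment> \<open>Here the sign of \<open>c (N + 1)\<close> is unknown, but both sides vanish.\<close>
    have "1 \<le> k" using k by simp
    then obtain C where "\<forall>(s, t) \<in> triangle2. norm (Y s t k) \<le> C * \<omega> s t powr (real k / p)"
      using reg by blast
    with True in_triangle show ?thesis by auto
  next
    case False
    then have c1: "1 \<le> c (N + 1)"
      using factorial_control_constant_ge_1[OF assms(5) _ st, of "N + 1"] nonneg[OF st] by simp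
    interpret small_rough_path p \<beta> \<omega> R c Y N
    proof
      fix k s t assume *: "1 \<le> k" "k \<le> N" "0 \<le> s" "s \<le> t" "t \<le> (1 :: real)"
      then have "norm (Y s t k) \<le> \<omega> s t powr (real k / p) / (\<beta> * fact k powr (1 / p))"
        using ext[of s t k] assms(8)[of k s t] by (simp add: triangle2_def)
      then show "norm (Y s t k) \<le> (\<omega> s t ^ k / fact k) powr (1 / p) / \<beta>"
        using powr_ratio_eq[of "\<omega> s t" k p] nonneg[of s t] * assms(1) by (simp add: mult.commute)
    qed (use assms(1,2,4,5,7) c1 mult reg in \<open>auto simp: multiplicative_functional_def triangle2_def triangle3_def\<close>)
    show ?thesis
      using level_bound[of k s t] powr_ratio_eq[of "\<omega> s t" k p] nonneg[OF st] k st assms(1)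
      by (simp add: mult.commute)
  qed
qed

end
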